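(* Let $(G,+)$ be an abelian group. Let $M$ be a loopless matroid over $G$ and $N$ a loopless paving matroid over $G$, both of rank $n>0$, with $0\notin E(N)$ and $$|E(M)|\leq \min\{\,p(G)-1,\;|E(N)|\,\}.$$ If $\mathcal{M}$ is a basis of $M$, then either $\mathcal{M}$ is matched to a basis of $N$, or there exists a set $S\subseteq E(N)$ that can be relaxed in $N$ such that $\mathcal{M}$ is matched to a basis of the relaxation $\mathrm{Rel}_S(N)$.
   Context: A matroid $M$ over an abelian group $G$ is a matroid whose finite ground set $E(M)$ is a subset of $G$. A matroid is loopless if it has no one-element circuit. A matroid of rank $n$ is paving if every $(n-1)$-subset of its ground set is independent. $p(G)$ denotes the smallest cardinality of a nontrivial (i.e. nonzero) finite subgroup of $G$, with $p(G)=\infty$ if $G$ has no nontrivial finite subgroup (and then $p(G)-1=\infty$). For matroids $M$ and $N'$ over $G$ with $r(M)=r(N')=n>0$ and ordered bases $\mathcal{M}=\{a_1,\dots,a_n\}$ of $M$ and $\mathcal{N}=\{b_1,\dots,b_n\}$ of $N'$, $\mathcal{M}$ is matched to $\mathcal{N}$ if $a_i+b_i\notin E(M)$ for all $i\in\{1,\dots,n\}$; an unordered basis is said to be matched to another if the two can be ordered so that this holds. Relaxation: let $N$ be a matroid of rank $n$ with set of bases $\mathcal{B}$, let $S\subseteq E(N)$, and let $\binom{S}{n}$ be the family of $n$-subsets of $S$. Suppose no element of $\binom{S}{n}$ is a basis of $N$. Then $S$ can be relaxed if $\mathcal{B}\cup\binom{S}{n}$ is again the set of bases of a matroid on $E(N)$;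 this matroid is called the relaxation of $N$ at $S$ and is denoted $\mathrm{Rel}_S(N)$. *)

theory Defs
  imports Main "HOL-Library.Extended_Nat" "HOL-Library.Ramsey"
begin

locale matroid =
  fixes E :: "'a set" and ind :: "'a set \<Rightarrow> bool"
  assumes finite_ground: "finite E"
    and ind_subset_ground: "ind X \<Longrightarrow> X \<subseteq> E"
    and ind_empty: "ind {}"
    and ind_mono: "ind X \<Longrightarrow> Y \<subseteq> X \<Longrightarrow> ind Y"
    and augment: "ind X \<Longrightarrow> ind Y \<Longrightarrow> card Y < card X \<Longrightarrow> \<exists>x\<in>X - Y. ind (insert x Y)"

definition bases :: "('a set \<Rightarrow> bool) \<Rightarrow> 'a set set" where
  "bases ind = {B. ind B \<and> (\<forall>X. ind X \<longrightarrow> B \<subseteq> X \<longrightarrow> X = B)}"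

definition rank :: "('a set \<Rightarrow> bool) \<Rightarrow> nat" where
  "rank ind = Max (card ` {X. ind X})"

definition circuit :: "'a set \<Rightarrow> ('a set \<Rightarrow> bool) \<Rightarrow> 'a set \<Rightarrow> bool" where
  "circuit E ind C \<longleftrightarrow> C \<subseteq> E \<and> \<not> ind C \<and> (\<forall>D. D \<subset> C \<longrightarrow> ind D)"

definition loopless :: "'a set \<Rightarrow> ('a set \<Rightarrow> bool) \<Rightarrow> bool" where
  "loopless E ind \<longleftrightarrow> \<not> (\<exists>C. circuit E ind C \<and> card C = 1)"

text \<open>Used only in positive rank, so the truncated subtraction is harmless.
  \<open>nsets A k\<close> is the family of \<open>k\<close>-element subsets of \<open>A\<close>.\<close>

definition paving :: "'a set \<Rightarrow> ('a set \<Rightarrow> bool) \<Rightarrow> bool" where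
  "paving E ind \<longleftrightarrow> (\<forall>X \<in> nsets E (rank ind - 1). ind X)"

definition can_be_relaxed :: "'a set \<Rightarrow> ('a set \<Rightarrow> bool) \<Rightarrow> 'a set \<Rightarrow> bool" where
  "can_be_relaxed E ind S \<longleftrightarrow>
     S \<subseteq> E \<and> nsets S (rank ind) \<inter> bases ind = {} \<and>
     (\<exists>ind'. matroid E ind' \<and> bases ind' = bases ind \<union> nsets S (rank ind))"

text \<open>The independent sets of \<open>Rel\<^sub>S(N)\<close>, recovered from its bases; the ground set is unchanged.
  Meaningful only when \<open>S\<close> can be relaxed: see \<open>matroid_relaxation\<close> and \<open>bases_relaxation\<close> below.\<close>

definition relaxation :: "('a set \<Rightarrow> bool) \<Rightarrow> 'a set \<Rightarrow> 'a set \<Rightarrow> bool" where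
  "relaxation ind S X \<longleftrightarrow> (\<exists>B \<in> bases ind \<union> nsets S (rank ind). X \<subseteq> B)"

definition add_subgroup :: "'a::ab_group_add set \<Rightarrow> bool" where
  "add_subgroup H \<longleftrightarrow> 0 \<in> H \<and> (\<forall>x\<in>H. \<forall>y\<in>H. x + y \<in> H) \<and> (\<forall>x\<in>H. - x \<in> H)"

text \<open>The invariant \<open>p(G)\<close> of the group \<open>G\<close> carried by the type \<open>'a\<close>.  In \<open>enat\<close> the infimum of
  the empty set is \<open>\<infinity>\<close>, and \<open>\<infinity> - 1 = \<infinity>\<close>.\<close>

definition min_subgroup_card :: "'a::ab_group_add itself \<Rightarrow> enat" where
  "min_subgroup_card _ = Inf {enat (card H) | H :: 'a set. add_subgroup H \<and> finite H \<and> H \<noteq> {0}}"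

text \<open>Matching depends on the first matroid \<open>M\<close> only through its ground set \<open>E = E(M)\<close>.\<close>

definition ordered_matched :: "'a::ab_group_add set \<Rightarrow> 'a list \<Rightarrow> 'a list \<Rightarrow> bool" where
  "ordered_matched E as bs \<longleftrightarrow> length as = length bs \<and> (\<forall>i<length as. as ! i + bs ! i \<notin> E)"

definition matched :: "'a::ab_group_add set \<Rightarrow> 'a set \<Rightarrow> 'a set \<Rightarrow> bool" where
  "matched E A B \<longleftrightarrow> (\<exists>as bs. distinct as \<and> set as = A \<and> distinct bs \<and> set bs = B \<and>
     ordered_matched E as bs)"

lemma (in matroid) ind_iff_subset_basis: "ind X \<longleftrightarrow> (\<exists>B \<in> bases ind. X \<subseteq> B)"
proof
  assume X: "ind X"
  have "finite {Y. ind Y \<and> X \<subseteq> Y}"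
    by (rule finite_subset[of _ "Pow E"]) (use finite_ground ind_subset_ground in auto)
  then obtain B where "ind B" "X \<subseteq> B" "\<And>Y. ind Y \<Longrightarrow> X \<subseteq> Y \<Longrightarrow> B \<subseteq> Y \<Longrightarrow> B = Y"
    using finite_has_maximal2[of "{Y. ind Y \<and> X \<subseteq> Y}" X] X by auto
  then have "B \<in> bases ind"
    by (auto simp: bases_def)
  then show "\<exists>B \<in> bases ind. X \<subseteq> B"
    using \<open>X \<subseteq> B\<close> by blast
next
  assume "\<exists>B \<in> bases ind. X \<subseteq> B"
  then obtain B where "ind B" "X \<subseteq> B"
    by (auto simp: bases_def)
  then show "ind X"
    by (rule ind_mono)
qed

lemma relaxation_eq:
  assumes "matroid E ind'" "bases ind' = bases ind \<union> nsets S (rank ind)"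
  shows "relaxation ind S = ind'"
  by (rule ext) (simp only: relaxation_def matroid.ind_iff_subset_basis[OF assms(1)] assms(2)[symmetric])

lemma
  assumes "can_be_relaxed E ind S"
  shows matroid_relaxation: "matroid E (relaxation ind S)"
    and bases_relaxation: "bases (relaxation ind S) = bases ind \<union> nsets S (rank ind)"
proof -
  obtain ind' where *: "matroid E ind'" "bases ind' = bases ind \<union> nsets S (rank ind)"
    using assms unfolding can_be_relaxed_def by blast
  note eq = relaxation_eq[OF *]
  show "matroid E (relaxation ind S)" "bases (relaxation ind S) = bases ind \<union> nsets S (rank ind)"
    by (simp_all only: eq *)
qed

end

theory Submission
  imports Defs
begin

text \<open>
  For a nonempty subset \<open>J\<close> of the basis \<open>A\<close>, let \<open>U\<close> consist of those \<open>b \<in> E\<^sub>N\<close> with \<open>J + b \<subseteq> E\<^sub>M\<close>.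
  As \<open>0 \<notin> U\<close> and \<open>J + (U \<union> {0}) \<subseteq> E\<^sub>M\<close> has fewer than \<open>p(G)\<close> elements, the Cauchy--Davenport
  inequality gives \<open>|J| + |U| \<le> |E\<^sub>M| \<le> |E\<^sub>N|\<close>.  Hence at least \<open>|J|\<close> elements of \<open>E\<^sub>N\<close> are
  admissible partners for some element of \<open>J\<close>; this is Hall's condition, so \<open>A\<close> is matched to
  some \<open>n\<close>-subset \<open>X\<close> of \<open>E\<^sub>N\<close> (lemma \<open>ex_matched_subset\<close>).

  Nothing so far makes \<open>X\<close> a basis of \<open>N\<close>.  If it is not one, then, \<open>N\<close> being paving, \<open>X\<close> spans a
  hyperplane \<open>H\<close> all of whose subsets of size \<open>n - 1\<close> are independent.  Two hyperplanes of a
  paving matroid that share \<open>n - 1\<close> elements coincide, and this is what basis exchange needs for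
  \<open>H\<close> to be relaxed (lemma \<open>ex_relaxation_containing\<close>).  The set \<open>X\<close> is a basis of that
  relaxation.
\<close>

section \<open>The Cauchy--Davenport inequality in abelian groups\<close>

text \<open>A finite set has a finite stabilizer: it embeds into the set by acting on one point.  Here
  the stabilizer is nontrivial because it contains \<open>B\<close>.\<close>

lemma ex_subgroup_if_translation_invariant:
  fixes A B :: "'a::ab_group_add set"
  assumes "finite A" "A \<noteq> {}" "b \<in> B" "b \<noteq> 0"
    and closed: "\<And>a b. a \<in> A \<Longrightarrow> b \<in> B \<Longrightarrow> a + b \<in> A"
  shows "\<exists>H :: 'a set. add_subgroup H \<and> finite H \<and> H \<noteq> {0} \<and> card H \<le> card A"
proof -
  define H where "H = {g. \<forall>a\<in>A. a + g \<in> A}"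
  have neg: "- g \<in> H" if g: "g \<in> H" for g
  proof -
    \<comment> \<open>Translation by \<open>g\<close> permutes the finite set \<open>A\<close>, so it can be undone inside \<open>A\<close>.\<close>
    have "(\<lambda>a. a + g) ` A = A"
      using g by (intro endo_inj_surj[OF \<open>finite A\<close>]) (auto simp: H_def)
    then have "\<exists>c\<in>A. a = c + g" if "a \<in> A" for a
      using that by blast
    then show ?thesis
      unfolding H_def by fastforce
  qed
  have "add_subgroup H"
    unfolding add_subgroup_def using neg by (auto simp: H_def simp flip: add.assoc)
  obtain a where a: "a \<in> A"
    using \<open>A \<noteq> {}\<close> by blast
  have inj: "inj_on ((+) a) H" and sub: "(+) a ` H \<subseteq> A"
    using a by (auto simp: H_def)
  have "finite H" "card H \<le> card A"
    using inj_on_finite[OF inj sub \<open>finite A\<close>] card_inj_on_le[OF inj sub \<open>finite A\<close>] by auto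
  moreover have "b \<in> H"
    using closed \<open>b \<in> B\<close> by (auto simp: H_def)
  ultimately show ?thesis
    using \<open>add_subgroup H\<close> \<open>b \<noteq> 0\<close> by blast
qed

text \<open>The inequality \<open>|A + B| \<ge> min (p(G)) (|A| + |B| - 1)\<close>, with the minimum spelled out.  The
  proof is Dyson's: for \<open>e \<in> A\<close>, passing from \<open>(A, B)\<close> to \<open>(A \<union> (e + B), B \<inter> (A - e))\<close> keeps
  \<open>|A| + |B|\<close>, does not enlarge the sumset, and keeps \<open>0\<close> in the second set.  When no choice
  of \<open>e\<close> shrinks the second set, \<open>A + B \<subseteq> A\<close> and \<open>B\<close> stabilizes \<open>A\<close>.\<close>

lemma Cauchy_Davenport:
  fixes A B S :: "'a::ab_group_add set"
  assumes "finite S" "finite A" "A \<noteq> {}" "finite B" "0 \<in> B"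
    and "\<And>a b. a \<in> A \<Longrightarrow> b \<in> B \<Longrightarrow> a + b \<in> S"
  shows "card A + card B \<le> card S + 1 \<or>
    (\<exists>H :: 'a set. add_subgroup H \<and> finite H \<and> H \<noteq> {0} \<and> card H \<le> card S)"
  using assms(2-)
proof (induction "card B" arbitrary: A B rule: less_induct)
  case less
  have "A \<subseteq> S"
    using less.prems(4,5) by force
  then have cardA: "card A \<le> card S"
    using \<open>finite S\<close> by (rule card_mono[rotated])
  show ?case
  proof (cases "\<exists>e\<in>A. \<exists>b\<in>B. e + b \<notin> A")
    case True
    then obtain e b where e: "e \<in> A" and b: "b \<in> B" "e + b \<notin> A"
      by blast
    define A' where "A' = A \<union> (+) e ` B"
    define B' where "B' = {b \<in> B. e + b \<in> A}"
    have "B' \<subset> B"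
      using b by (auto simp: B'_def)
    then have lt: "card B' < card B"
      using less.prems(3) by (rule psubset_card_mono[rotated])
    have A'_eq: "A' = A \<union> (+) e ` (B - B')"
      by (auto simp: A'_def B'_def)
    have "card A' = card A + card (B - B')"
      unfolding A'_eq using less.prems(1,3)
      by (subst card_Un_disjoint) (auto simp: B'_def card_image)
    moreover have "card (B - B') = card B - card B'" "card B' \<le> card B"
      using less.prems(3) lt by (auto simp: B'_def intro!: card_Diff_subset)
    ultimately have eq: "card A' + card B' = card A + card B"
      by linarith
    have sum: "x + y \<in> S" if x: "x \<in> A'" and y: "y \<in> B'" for x y
    proof (cases "x \<in> A")
      case True
      then show ?thesis
        using less.prems(5) y by (auto simp: B'_def)
    next
      case False
      then obtain c where c: "c \<in> B" "x = e + c"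
        using x by (auto simp: A'_def)
      have "(e + y) + c \<in> S"
        using less.prems(5) y c(1) by (auto simp: B'_def)
      then show ?thesis
        using c(2) by (simp add: algebra_simps)
    qed
    have "card A' + card B' \<le> card S + 1 \<or>
      (\<exists>H :: 'a set. add_subgroup H \<and> finite H \<and> H \<noteq> {0} \<and> card H \<le> card S)"
      using less.prems e by (intro less.hyps[OF lt] sum) (auto simp: A'_def B'_def)
    then show ?thesis
      by (simp only: eq)
  next
    case False
    show ?thesis
    proof (cases "B = {0}")
      case True
      then show ?thesis
        using cardA by simp
    next
      case B: False
      then obtain b where "b \<in> B" "b \<noteq> 0"
        using less.prems(4) by blast
      then obtain H :: "'a set" where
        "add_subgroup H" "finite H" "H \<noteq> {0}" "card H \<le> card A"
        using ex_subgroup_if_translation_invariant[OF less.prems(1,2)] False by blast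
      then show ?thesis
        using cardA le_trans by blast
    qed
  qed
qed

section \<open>Hall's marriage theorem\<close>

text \<open>Rado's argument: while some \<open>F i\<close> has two elements \<open>x\<close> and \<open>y\<close>, one of them can be deleted
  from \<open>F i\<close> without violating Hall's condition.  Otherwise there are families \<open>J\<close> and \<open>K\<close> of other
  indices such that deleting \<open>x\<close> violates the condition on \<open>insert i J\<close> and deleting \<open>y\<close> violates it
  on \<open>insert i K\<close>; the neighbourhoods of these two index sets cover that of
  \<open>insert i (J \<union> K)\<close> and meet in at least that of \<open>J \<inter> K\<close>, so submodularity of the
  cardinality yields a contradiction.\<close>

theorem Hall_marriage:
  assumes "finite I" "\<And>i. i \<in> I \<Longrightarrow> finite (F i)"
    and "\<And>J. J \<subseteq> I \<Longrightarrow> card J \<le> card (\<Union>(F ` J))"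
  shows "\<exists>f. inj_on f I \<and> (\<forall>i\<in>I. f i \<in> F i)"
  using assms(2,3)
proof (induction "\<Sum>i\<in>I. card (F i)" arbitrary: F rule: less_induct)
  case less
  note fin = less.prems(1) and hall = less.prems(2)
  have nonempty: "F i \<noteq> {}" if "i \<in> I" for i
    using hall[of "{i}"] that by auto
  show ?case
  proof (cases "\<exists>i\<in>I. \<exists>x\<in>F i. \<exists>y\<in>F i. x \<noteq> y")
    case False
    define f where "f i = (SOME x. x \<in> F i)" for i
    have f: "f i \<in> F i" if "i \<in> I" for i
      using nonempty[OF that] by (auto simp: f_def some_in_eq)
    then have Ff: "F i = {f i}" if "i \<in> I" for i
      using that False by blast
    have "inj_on f I"
    proof (rule inj_onI, rule ccontr)
      fix i j
      assume ij: "i \<in> I" "j \<in> I" "f i = f j" "i \<noteq> j"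
      then show False
        using hall[of "{i, j}"] Ff[of i] Ff[of j] by simp
    qed
    then show ?thesis
      using f by blast
  next
    case True
    then obtain i x y where i: "i \<in> I" and xy: "x \<in> F i" "y \<in> F i" "x \<noteq> y"
      by blast
    define G where "G z = F(i := F i - {z})" for z
    show ?thesis
    proof (cases "\<exists>z\<in>F i. \<forall>J\<subseteq>I. card J \<le> card (\<Union>(G z ` J))")
      case True
      then obtain z where z: "z \<in> F i" and G: "\<And>J. J \<subseteq> I \<Longrightarrow> card J \<le> card (\<Union>(G z ` J))"
        by blast
      have "card (G z i) < card (F i)"
        unfolding G_def using z fin[OF i] by (simp del: card_Diff_insert add: card_Diff1_less)
      then have "(\<Sum>k\<in>I. card (G z k)) < (\<Sum>k\<in>I. card (F k))"
        using \<open>finite I\<close> i by (intro sum_strict_mono_ex1) (auto simp: G_def card_Diff1_le)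
      then obtain f where "inj_on f I" "\<forall>k\<in>I. f k \<in> G z k"
        using less.hyps[of "G z"] G fin by (force simp: G_def)
      then show ?thesis
        by (intro exI[of _ f]) (auto simp: G_def split: if_splits)
    next
      case False
      have violator: "\<exists>J \<subseteq> I - {i}. card (\<Union>(F ` J) \<union> (F i - {z})) \<le> card J" if "z \<in> F i" for z
      proof -
        obtain J where J: "J \<subseteq> I" "card (\<Union>(G z ` J)) < card J"
          using False \<open>z \<in> F i\<close> by (meson not_le)
        have eq: "G z ` (J - {i}) = F ` (J - {i})"
          by (auto simp: G_def)
        have "i \<in> J"
        proof (rule ccontr)
          assume "i \<notin> J"
          then show False
            using J hall[of J] eq by auto
        qed
        then have "\<Union>(G z ` J) = \<Union>(F ` (J - {i})) \<union> (F i - {z})"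
          using eq by (auto simp: G_def)
        moreover have "card J = Suc (card (J - {i}))"
          using \<open>i \<in> J\<close> J(1) \<open>finite I\<close> by (metis card_Suc_Diff1 finite_subset)
        ultimately show ?thesis
          using J by (intro exI[of _ "J - {i}"]) auto
      qed
      obtain J where J: "J \<subseteq> I - {i}" "card (\<Union>(F ` J) \<union> (F i - {x})) \<le> card J"
        using violator xy(1) by blast
      obtain K where K: "K \<subseteq> I - {i}" "card (\<Union>(F ` K) \<union> (F i - {y})) \<le> card K"
        using violator xy(2) by blast
      let ?P = "\<Union>(F ` J) \<union> (F i - {x})" and ?Q = "\<Union>(F ` K) \<union> (F i - {y})"
      have finJK: "finite J" "finite K"
        using J(1) K(1) \<open>finite I\<close> by (auto intro: finite_subset)
      have finPQ: "finite ?P" "finite ?Q"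
        using J(1) K(1) finJK fin i by auto
      have "?P \<union> ?Q = \<Union>(F ` insert i (J \<union> K))"
        using xy by auto
      then have "card (insert i (J \<union> K)) \<le> card (?P \<union> ?Q)"
        using hall[of "insert i (J \<union> K)"] J(1) K(1) i
        by (metis Diff_subset Un_subset_iff insert_subset subset_trans)
      moreover have "card (insert i (J \<union> K)) = Suc (card (J \<union> K))"
        using J(1) K(1) finJK by (intro card_insert_disjoint) auto
      moreover have "card (J \<inter> K) \<le> card (?P \<inter> ?Q)"
      proof (rule order_trans)
        show "card (J \<inter> K) \<le> card (\<Union>(F ` (J \<inter> K)))"
          using J(1) by (intro hall) auto
        show "card (\<Union>(F ` (J \<inter> K))) \<le> card (?P \<inter> ?Q)"
          using finPQ by (intro card_mono) auto
      qed
      ultimately show ?thesis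
        using J(2) K(2) card_Un_Int[OF finPQ] card_Un_Int[OF finJK] by linarith
    qed
  qed
qed

section \<open>Matching a finite set into another\<close>

lemma matched_image:
  assumes "finite A" "inj_on f A" "\<And>a. a \<in> A \<Longrightarrow> a + f a \<notin> E"
  shows "matched E A (f ` A)"
proof -
  obtain as where "distinct as" "set as = A"
    using finite_distinct_list[OF \<open>finite A\<close>] by blast
  then show ?thesis
    unfolding matched_def ordered_matched_def using assms
    by (intro exI[of _ as] exI[of _ "map f as"]) (auto simp: distinct_map)
qed

text \<open>Since \<open>|E| < p(G)\<close>, a subgroup small enough to spoil the Cauchy--Davenport inequality inside
  \<open>E\<close> is trivial; what remains of the inequality is Hall's condition.  The hypothesis \<open>0 \<notin> F\<close>
  supplies the one element that compensates for the \<open>- 1\<close> in Cauchy--Davenport.\<close>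

lemma ex_matched_subset:
  fixes A E F :: "'a::ab_group_add set"
  assumes "finite E" "finite F" "A \<subseteq> E" "0 \<notin> F" "card E \<le> card F"
    and small: "enat (card E) \<le> min_subgroup_card TYPE('a) - 1"
  shows "\<exists>X \<subseteq> F. card X = card A \<and> matched E A X"
proof -
  have no_subgroup: "card E < card H" if H: "add_subgroup H" "finite H" "H \<noteq> {0}" for H :: "'a set"
  proof -
    have "card H > 0"
      using H by (auto simp: card_gt_0_iff add_subgroup_def)
    have "min_subgroup_card TYPE('a) \<le> enat (card H)"
      unfolding min_subgroup_card_def by (rule Inf_lower) (use H in blast)
    then show ?thesis
      using small \<open>card H > 0\<close>
      by (cases "min_subgroup_card TYPE('a)") (auto simp: one_enat_def)
  qed
  have "finite A"
    using \<open>A \<subseteq> E\<close> \<open>finite E\<close> by (rule finite_subset)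
  define N where "N a = {b \<in> F. a + b \<notin> E}" for a
  have "card J \<le> card (\<Union>(N ` J))" if "J \<subseteq> A" for J
  proof (cases "J = {}")
    case False
    define U where "U = F - \<Union>(N ` J)"
    have finU: "finite U"
      using \<open>finite F\<close> by (simp add: U_def)
    have sum: "a + b \<in> E" if "a \<in> J" "b \<in> insert 0 U" for a b
      using that \<open>J \<subseteq> A\<close> \<open>A \<subseteq> E\<close> by (auto simp: U_def N_def)
    have "finite J"
      using that \<open>finite A\<close> by (rule finite_subset)
    then have "card J + card (insert 0 U) \<le> card E + 1"
      using Cauchy_Davenport[of E J "insert 0 U", OF \<open>finite E\<close> _ False _ _ sum] finU
        no_subgroup by (metis finite_insert insertI1 not_le)
    moreover have "card (insert 0 U) = Suc (card U)"
      using \<open>0 \<notin> F\<close> finU by (intro card_insert_disjoint) (auto simp: U_def)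
    moreover have "card U = card F - card (\<Union>(N ` J))" "card (\<Union>(N ` J)) \<le> card F"
      using \<open>finite F\<close> unfolding U_def
      by (auto simp: N_def intro!: card_Diff_subset card_mono intro: finite_subset[of _ F])
    ultimately show ?thesis
      using \<open>card E \<le> card F\<close> by linarith
  qed simp
  then obtain f where f: "inj_on f A" "\<forall>a\<in>A. f a \<in> N a"
    using Hall_marriage[OF \<open>finite A\<close>, of N] \<open>finite F\<close> by (auto simp: N_def)
  then have "matched E A (f ` A)"
    using \<open>finite A\<close> by (intro matched_image) (auto simp: N_def)
  moreover have "f ` A \<subseteq> F" "card (f ` A) = card A"
    using f by (auto simp: N_def card_image)
  ultimately show ?thesis
    by blast
qed

section \<open>Relaxing a hyperplane of a paving matroid\<close>

context matroid
begin

lemma finite_ind: "ind X \<Longrightarrow> finite X"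
  using finite_ground ind_subset_ground finite_subset by blast

lemma finite_Collect_ind: "finite {X. ind X}"
  using finite_ground ind_subset_ground by (auto intro: finite_subset[of _ "Pow E"])

lemma card_le_rank: "ind X \<Longrightarrow> card X \<le> rank ind"
  unfolding rank_def using finite_Collect_ind by (intro Max_ge) auto

lemma ex_ind_card_rank: "\<exists>X. ind X \<and> card X = rank ind"
proof -
  have "rank ind \<in> card ` {X. ind X}"
    unfolding rank_def using finite_Collect_ind ind_empty by (intro Max_in) auto
  then show ?thesis
    by auto
qed

lemma bases_iff: "B \<in> bases ind \<longleftrightarrow> ind B \<and> card B = rank ind"
proof
  assume B: "B \<in> bases ind"
  obtain X where X: "ind X" "card X = rank ind"
    using ex_ind_card_rank by blast
  have "\<not> card B < rank ind"
  proof
    assume "card B < rank ind"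
    then obtain x where "x \<in> X - B" "ind (insert x B)"
      using augment[of X B] X B by (auto simp: bases_def)
    then show False
      using B by (auto simp: bases_def)
  qed
  then show "ind B \<and> card B = rank ind"
    using B card_le_rank[of B] by (auto simp: bases_def)
next
  assume B: "ind B \<and> card B = rank ind"
  then show "B \<in> bases ind"
    unfolding bases_def using card_subset_eq[OF finite_ind] card_le_rank
      card_mono[OF finite_ind] by (simp, metis le_antisym)
qed

text \<open>The closure operator of the matroid, in a form that is correct only for independent \<open>I\<close>.\<close>

definition span_ind :: "'a set \<Rightarrow> 'a set" where
  "span_ind I = {x \<in> E. x \<in> I \<or> \<not> ind (insert x I)}"

lemma subset_span_ind: "ind I \<Longrightarrow> I \<subseteq> span_ind I"
  using ind_subset_ground by (auto simp: span_ind_def)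

lemma card_ind_le_if_subset_span_ind:
  assumes "ind I" "ind Z" "Z \<subseteq> span_ind I"
  shows "card Z \<le> card I"
proof (rule ccontr)
  assume "\<not> card Z \<le> card I"
  then obtain x where "x \<in> Z - I" "ind (insert x I)"
    using augment[of Z I] assms by auto
  then show False
    using assms(3) by (auto simp: span_ind_def)
qed

text \<open>A maximum independent subset of a closed set spans it.\<close>

lemma span_ind_eq:
  assumes I: "ind I" and J: "ind J" "J \<subseteq> span_ind I" and card: "card J = card I"
  shows "span_ind J = span_ind I"
proof -
  have sub: "span_ind I \<subseteq> span_ind J"
    if "ind I" "ind J" "J \<subseteq> span_ind I" "card J = card I" for I J
  proof
    fix x
    assume x: "x \<in> span_ind I"
    show "x \<in> span_ind J"
    proof (rule ccontr)
      assume "x \<notin> span_ind J"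
      then have "ind (insert x J)" "x \<notin> J"
        using x by (auto simp: span_ind_def)
      then show False
        using card_ind_le_if_subset_span_ind[of I "insert x J"] that x finite_ind[of J] by simp
    qed
  qed
  show ?thesis
    using sub[OF I J card] sub[OF J(1) I _ card[symmetric]] subset_span_ind[OF I] by blast
qed

lemma paving_ind:
  assumes "paving E ind" "X \<subseteq> E" "card X < rank ind"
  shows "ind X"
proof -
  have "rank ind \<le> card E"
    using ex_ind_card_rank ind_subset_ground finite_ground by (metis card_mono)
  then obtain Y where "X \<subseteq> Y" "Y \<subseteq> E" "card Y = rank ind - 1"
    using exists_subset_between[of X "rank ind - 1" E] assms finite_ground by force
  then show ?thesis
    using assms(1) ind_mono[of Y X] finite_ground finite_subset[of Y E]
    by (auto simp: paving_def nsets_def)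
qed

text \<open>Let \<open>H\<close> be the hyperplane spanned by \<open>I\<close>.  Only one case of the exchange axiom is not
  immediate: extending some \<open>Y\<close> of size \<open>n - 1\<close> by an element of a new basis \<open>X \<subseteq> H\<close>.  If this is
  impossible, then \<open>X\<close> lies in the hyperplane spanned by \<open>Y\<close>.  As any \<open>n - 1\<close> elements of \<open>X\<close> are
  independent, they span both hyperplanes, which are therefore equal; but then adding to \<open>Y\<close> any
  element of \<open>X - Y\<close> gives an \<open>n\<close>-subset of \<open>H\<close>, which is independent after the relaxation.\<close>

lemma hyperplane_can_be_relaxed:
  assumes paving: "paving E ind" and I: "ind I" and cardI: "Suc (card I) = rank ind"
  shows "can_be_relaxed E ind (span_ind I)"
proof -
  define H where "H = span_ind I"
  define n where "n = rank ind"
  define ind' where "ind' X \<longleftrightarrow> ind X \<or> X \<subseteq> H \<and> card X = n" for X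
  have "H \<subseteq> E"
    by (auto simp: H_def span_ind_def)
  then have finH: "finite H"
    using finite_ground finite_subset by blast
  have small: "ind X" if "X \<subseteq> E" "card X < n" for X
    using paving_ind[OF paving that(1)] that(2) by (simp add: n_def)
  have no_basis: "\<not> ind X" if "X \<subseteq> H" "card X = n" for X
    using card_ind_le_if_subset_span_ind[OF I, of X] that cardI by (auto simp: H_def n_def)
  have ground': "X \<subseteq> E" if "ind' X" for X
    using that \<open>H \<subseteq> E\<close> ind_subset_ground by (auto simp: ind'_def)
  have card': "card X \<le> n" if "ind' X" for X
    using that card_le_rank by (auto simp: ind'_def n_def)
  have finite': "finite X" if "ind' X" for X
    using ground'[OF that] finite_ground finite_subset by blast
  have augment': "\<exists>x\<in>X - Y. ind' (insert x Y)"
    if X: "ind' X" and Y: "ind' Y" and lt: "card Y < card X" for X Y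
  proof -
    have card_insert: "card (insert x Y) = Suc (card Y)" if "x \<in> X - Y" for x
      using that finite'[OF Y] by simp
    obtain x where x: "x \<in> X - Y"
      using lt finite'[OF Y] card_mono[of Y X] by (meson DiffI not_le subsetI)
    have ind_Y: "ind Y"
      using small[of Y] ground'[OF Y] lt card'[OF X] by simp
    consider "Suc (card Y) < n" | "ind X" | "X \<subseteq> H" "card X = n" "Suc (card Y) = n"
      using lt card'[OF X] X by (fastforce simp: ind'_def)
    then show ?thesis
    proof cases
      case 1
      then have "ind (insert x Y)"
        using x card_insert[OF x] ground'[OF X] ground'[OF Y] by (intro small) auto
      then show ?thesis
        using x by (auto simp: ind'_def)
    next
      case 2
      then show ?thesis
        using augment[OF 2 ind_Y lt] by (auto simp: ind'_def)
    next
      case 3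
      show ?thesis
      proof (rule ccontr)
        assume stuck: "\<not> ?thesis"
        then have "X \<subseteq> span_ind Y"
          using ground'[OF X] by (auto simp: ind'_def span_ind_def)
        obtain Z where Z: "Z \<subseteq> X" "card Z = card Y"
          using obtain_subset_with_card_n[of "card Y" X] lt by auto
        then have "ind Z"
          using small ground'[OF X] 3 by auto
        have "span_ind Y = span_ind Z" "span_ind I = span_ind Z"
          using span_ind_eq[OF ind_Y \<open>ind Z\<close>] span_ind_eq[OF I \<open>ind Z\<close>] Z 3 cardI
            \<open>X \<subseteq> span_ind Y\<close> by (auto simp: H_def n_def)
        then have "Y \<subseteq> H"
          using subset_span_ind[OF ind_Y] by (simp add: H_def)
        then have "ind' (insert x Y)"
          using x 3 card_insert[OF x] by (auto simp: ind'_def)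
        then show False
          using stuck x by blast
      qed
    qed
  qed
  have mono': "ind' Y" if X: "ind' X" and sub: "Y \<subseteq> X" for X Y
  proof (cases "ind X \<or> Y = X")
    case False
    then have "card Y < n"
      using X sub finite'[OF X] psubset_card_mono[of X Y] by (auto simp: ind'_def)
    then show ?thesis
      using small[of Y] ground'[OF X] sub by (auto simp: ind'_def)
  qed (use X sub ind_mono in \<open>auto simp: ind'_def\<close>)
  interpret M': matroid E ind'
  proof
    show "ind' {}"
      using ind_empty by (simp add: ind'_def)
  qed (fact finite_ground ground' augment' | erule (1) mono')+
  have rank': "rank ind' = n"
  proof (rule antisym)
    show "rank ind' \<le> n"
      using M'.ex_ind_card_rank card' by metis
    obtain X where "ind X" "card X = n"
      using ex_ind_card_rank unfolding n_def by blast
    then show "n \<le> rank ind'"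
      using M'.card_le_rank[of X] by (simp add: ind'_def)
  qed
  have "bases ind' = bases ind \<union> nsets H n"
    using finH finite_subset[of _ H]
    by (auto simp: M'.bases_iff bases_iff rank' ind'_def nsets_def simp flip: n_def)
  moreover have "nsets H n \<inter> bases ind = {}"
    using no_basis by (auto simp: nsets_def bases_iff)
  ultimately show ?thesis
    unfolding can_be_relaxed_def using M'.matroid_axioms \<open>H \<subseteq> E\<close> by (auto simp: H_def n_def)
qed

lemma ex_relaxation_containing:
  assumes paving: "paving E ind" and "rank ind > 0"
    and X: "X \<subseteq> E" "card X = rank ind" "X \<notin> bases ind"
  shows "\<exists>S. can_be_relaxed E ind S \<and> X \<in> bases (relaxation ind S)"
proof -
  have finX: "finite X"
    using X(1) finite_ground finite_subset by blast
  obtain I where I: "I \<subseteq> X" "card I = rank ind - 1"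
    using obtain_subset_with_card_n[of "rank ind - 1" X] X(2) by auto
  have "ind I"
    using I X(1) \<open>rank ind > 0\<close> by (intro paving_ind[OF paving]) auto
  have "X \<subseteq> span_ind I"
  proof
    fix x
    assume x: "x \<in> X"
    \<comment> \<open>If \<open>x \<notin> I\<close>, then \<open>insert x I\<close> has as many elements as \<open>X\<close>, so it is the dependent set \<open>X\<close>.\<close>
    have "insert x I = X" if "x \<notin> I"
      using that x I X(2) finX \<open>rank ind > 0\<close> finite_subset[OF I(1)]
      by (intro card_subset_eq) auto
    then show "x \<in> span_ind I"
      using x X by (auto simp: span_ind_def bases_iff)
  qed
  then have "X \<in> nsets (span_ind I) (rank ind)"
    using finX X(2) by (simp add: nsets_def)
  moreover have "can_be_relaxed E ind (span_ind I)"
    using hyperplane_can_be_relaxed[OF paving \<open>ind I\<close>] I(2) \<open>rank ind > 0\<close> by simp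
  ultimately show ?thesis
    using bases_relaxation by blast
qed

end

section \<open>Matching a basis to a basis of a relaxation\<close>

theorem theorem3p23:
  fixes E\<^sub>M E\<^sub>N A :: "'a::ab_group_add set"
    and ind\<^sub>M ind\<^sub>N :: "'a set \<Rightarrow> bool"
    and n :: nat
  assumes "matroid E\<^sub>M ind\<^sub>M" and "loopless E\<^sub>M ind\<^sub>M"
    and "matroid E\<^sub>N ind\<^sub>N" and "loopless E\<^sub>N ind\<^sub>N" and "paving E\<^sub>N ind\<^sub>N"
    and "rank ind\<^sub>M = n" and "rank ind\<^sub>N = n" and "n > 0"
    and "0 \<notin> E\<^sub>N"
    and "enat (card E\<^sub>M) \<le> min (min_subgroup_card TYPE('a) - 1) (enat (card E\<^sub>N))"
    and "A \<in> bases ind\<^sub>M"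
  shows "(\<exists>B \<in> bases ind\<^sub>N. matched E\<^sub>M A B) \<or>
         (\<exists>S. can_be_relaxed E\<^sub>N ind\<^sub>N S \<and> (\<exists>B \<in> bases (relaxation ind\<^sub>N S). matched E\<^sub>M A B))"
proof -
  interpret M: matroid E\<^sub>M ind\<^sub>M by fact
  interpret N: matroid E\<^sub>N ind\<^sub>N by fact
  have A: "A \<subseteq> E\<^sub>M" "card A = n"
    using \<open>A \<in> bases ind\<^sub>M\<close> M.ind_subset_ground \<open>rank ind\<^sub>M = n\<close> by (auto simp: M.bases_iff)
  obtain X where "X \<subseteq> E\<^sub>N" "card X = n" "matched E\<^sub>M A X"
    using ex_matched_subset[of E\<^sub>M E\<^sub>N A] A M.finite_ground N.finite_ground assms(9,10) by auto
  then show ?thesis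
    using N.ex_relaxation_containing[of X] assms(5,7,8) by metis
qed

end
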